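(* Consider the initial-value problem $\frac{\partial}{\partial t}(a(u)+w)+\frac{\partial}{\partial x}\alpha(u)=0$, $w(x,t)=\mathcal{H}(u(x,t))$, $u(x,0)=u^{init}(x)$, $v(x,0)=v^{init}(x)=(v_k^{init}(x))_{k=1}^K$, where $\mathcal{H}$ is a $K$-generalized play hysteresis operator with data $\{\mu_k,\gamma_{l,k},\gamma_{r,k},b_k\}_{k=1}^K$ (see context), and its approximation on a grid $x_j=jh$, $t_n=n\tau$ by the explicit–implicit upwind scheme: $U_j^0=u^{init}(x_j)$, $V_{k,j}^0=v_k^{init}(x_j)$, and at every time step $n>0$ and every $j$, solve for $(U_j^n,W_j^n)$ $$\tfrac1\tau\bigl(a(U_j^n)-a(U_j^{n-1})+W_j^n-W_j^{n-1}\bigr)+\tfrac1h\bigl(\alpha(U_j^{n-1})-\alpha(U_{j-1}^{n-1})\bigr)=0,$$ $$W_j^n=\sum_{k=1}^K\mu_kb_k\bigl(\mathcal{R}_k(V_{k,j}^{n-1};U_j^n)\bigr).$$ Assume the CFL condition $0\le\frac{\tau}{h}\max_u\frac{d\alpha}{du}\le1$. Then the scheme is uniquely solvable, and it is weakly $TV_T$ stable in the space $L^1\times(L^1)^K$; namely, $$TV_T\bigl(a(U),(W_k)_k\bigr)\le C(T),$$ where the constant $C(T)$ depends on the time $T$ but not on $\tau,h$.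
   Context: Here $\tau=T/N$ is the time step, $h>0$ is the spatial grid parameter, and the gridpoints $x_j=jh$ are taken on the support of $u^{init}$. The function $a:\mathbb{R}\to\mathbb{R}$ is continuous and strongly monotone, taken without loss of generality as $a=\mathrm{id}+a_0$ with $a_0$ continuous and non-decreasing; $\alpha$ is the advective flux function. $K$-generalized play: the output is $w=\mathcal{H}(u)=\sum_{k=1}^K w_k=\sum_{k=1}^K\mu_kb_k(v_k)$, where $v_k$ solves $\frac{d}{dt}v_k+\mathcal{C}(\gamma_{r,k}(u),\gamma_{l,k}(u);v_k)\ni0$ with $v_k(0)=v_k^{init}\in[\gamma_{r,k}(u^{init}),\gamma_{l,k}(u^{init})]$. Here, for $p\le q$, $\mathcal{C}(p,q;\cdot)$ is the subgradient of the indicator function of the interval $[p,q]$. The data satisfy, for $1\le k\le K$: $\mu_k>0$; $\gamma_{l,k},\gamma_{r,k}:\mathbb{R}\to\mathbb{R}$ are continuous and monotone (non-decreasing) with $\gamma_{r,k}\le\gamma_{l,k}$ (in the special case of linear play, $\gamma_{r,k}(u)=u-\beta_k$, $\gamma_{l,k}(u)=u-\alpha_k$ with numbers $\alpha_k\le\beta_k$); $b_k:\mathbb{R}\to\mathbb{R}$ is non-decreasing and Lipschitz continuous and is one of the following (with $h_k>0$, $\varepsilon>0$, $x_+=\max(x,0)$): the identity; $x\mapsto x_+-(x-h_k)_+$; $x\mapsto\frac{h_k}{\varepsilon}(x_+-(x-\varepsilon)_+)$; or a smooth function with range $[0,h_k]$ such as $x\mapsto\frac{h_k}{2}(\mathrm{erf}(2x-1)+1)$.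 Resolvent: $\mathcal{R}_k(\overline V;U)=\min\{\max\{\gamma_{r,k}(U),\overline V\},\gamma_{l,k}(U)\}$. In the scheme, $V_{k,j}^n=\mathcal{R}_k(V_{k,j}^{n-1};U_j^n)$ approximates $v_k(x_j,t_n)$. The component $W_k$ is the grid function $W_{k,j}^n=\mu_kb_k(V_{k,j}^n)$, so that $W_j^n=\sum_kW_{k,j}^n$. $TV_T(\cdot)$ denotes, in the usual sense of numerical methods for conservation laws, the total variation in space and time, over the time interval $[0,T]$, of the vector-valued grid function with the $K+1$ components $a(U),W_1,\dots,W_K$.
   Formalization: The formal statement assumes that a(u^init) and each μ_k b_k(v_k^init) have bounded variation on the line (without this the bound fails, e.g. α=0 with oscillating data), and reads the CFL condition pointwise: 0 ≤ (τ/h) α'(u) ≤ 1 for all u. *)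

theory Defs
  imports "HOL-Analysis.Analysis"
begin

definition pos_part :: "real \<Rightarrow> real" where
  "pos_part x = max x 0"

definition smooth_real :: "(real \<Rightarrow> real) \<Rightarrow> bool" where
  "smooth_real f \<longleftrightarrow> (\<forall>m x. (deriv ^^ m) f differentiable (at x))"

(* In the smooth case only "range f \<subseteq> {0..hk}" is asked, since the endpoints need not be
   attained: hk / 2 * (erf (2 * x - 1) + 1) has range {0<..<hk}. *)
definition play_output :: "real \<Rightarrow> real \<Rightarrow> (real \<Rightarrow> real) \<Rightarrow> bool" where
  "play_output hk \<epsilon> f \<longleftrightarrow>
     mono f \<and> (\<exists>L. L-lipschitz_on UNIV f) \<and>
     (f = (\<lambda>x. x)
      \<or> f = (\<lambda>x. pos_part x - pos_part (x - hk))
      \<or> f = (\<lambda>x. hk / \<epsilon> * (pos_part x - pos_part (x - \<epsilon>)))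
      \<or> smooth_real f \<and> range f \<subseteq> {0..hk})"

definition resolvent :: "(real \<Rightarrow> real) \<Rightarrow> (real \<Rightarrow> real) \<Rightarrow> real \<Rightarrow> real \<Rightarrow> real" where
  "resolvent \<gamma>r \<gamma>l v u = min (max (\<gamma>r u) v) (\<gamma>l u)"

(* The whole line is gridded (j ranges over all integers), and a numerical solution is
   constrained only at the time levels n \<le> N. *)
definition upwind_solution ::
  "(real \<Rightarrow> real) \<Rightarrow> (real \<Rightarrow> real) \<Rightarrow> ('k::finite \<Rightarrow> real) \<Rightarrow> ('k \<Rightarrow> real \<Rightarrow> real) \<Rightarrow>
   ('k \<Rightarrow> real \<Rightarrow> real) \<Rightarrow> ('k \<Rightarrow> real \<Rightarrow> real) \<Rightarrow> (real \<Rightarrow> real) \<Rightarrow> ('k \<Rightarrow> real \<Rightarrow> real) \<Rightarrow>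
   real \<Rightarrow> real \<Rightarrow> nat \<Rightarrow>
   (nat \<Rightarrow> int \<Rightarrow> real) \<Rightarrow> ('k \<Rightarrow> nat \<Rightarrow> int \<Rightarrow> real) \<Rightarrow> (nat \<Rightarrow> int \<Rightarrow> real) \<Rightarrow> bool" where
  "upwind_solution a \<alpha> \<mu> b \<gamma>r \<gamma>l uinit vinit \<tau> h N U V W \<longleftrightarrow>
     (\<forall>j. U 0 j = uinit (of_int j * h)) \<and>
     (\<forall>k j. V k 0 j = vinit k (of_int j * h)) \<and>
     (\<forall>j. W 0 j = (\<Sum>k\<in>UNIV. \<mu> k * b k (V k 0 j))) \<and>
     (\<forall>n\<in>{1..N}. \<forall>j.
        1 / \<tau> * (a (U n j) - a (U (n - 1) j) + W n j - W (n - 1) j)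
          + 1 / h * (\<alpha> (U (n - 1) j) - \<alpha> (U (n - 1) (j - 1))) = 0 \<and>
        W n j = (\<Sum>k\<in>UNIV. \<mu> k * b k (resolvent (\<gamma>r k) (\<gamma>l k) (V k (n - 1) j) (U n j))) \<and>
        (\<forall>k. V k n j = resolvent (\<gamma>r k) (\<gamma>l k) (V k (n - 1) j) (U n j)))"

(* Total variation in space and time over [0, N * \<tau>] of the grid function (A, (B k)_k), with the
   sum of absolute values as norm on the components: spatial variation at the levels 0..N, weighted
   by \<tau>, plus the jumps between consecutive levels, weighted by h.  Values in ennreal, so that
   a divergent sum over j is infinite rather than 0. *)
definition TV_T ::
  "real \<Rightarrow> real \<Rightarrow> nat \<Rightarrow> (nat \<Rightarrow> int \<Rightarrow> real) \<Rightarrow> ('k::finite \<Rightarrow> nat \<Rightarrow> int \<Rightarrow> real) \<Rightarrow> ennreal" where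
  "TV_T \<tau> h N A B =
     (\<Sum>n\<le>N. ennreal \<tau> * (\<Sum>\<^sub>\<infinity>j\<in>UNIV. ennreal
        (\<bar>A n (j + 1) - A n j\<bar> + (\<Sum>k\<in>UNIV. \<bar>B k n (j + 1) - B k n j\<bar>)))) +
     (\<Sum>n<N. ennreal h * (\<Sum>\<^sub>\<infinity>j\<in>UNIV. ennreal
        (\<bar>A (n + 1) j - A n j\<bar> + (\<Sum>k\<in>UNIV. \<bar>B k (n + 1) j - B k n j\<bar>))))"

definition bounded_variation :: "(real \<Rightarrow> real) \<Rightarrow> bool" where
  "bounded_variation f \<longleftrightarrow>
     (\<exists>M. \<forall>(p :: nat \<Rightarrow> real) m. mono p \<longrightarrow> (\<Sum>i<m. \<bar>f (p (Suc i)) - f (p i)\<bar>) \<le> M)"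

(* The nonnegativity of the Courant number is imposed pointwise, i.e. it includes the monotonicity
   of the flux that upwinding from the left requires; 0 \<le> \<tau> / h * max \<alpha>' alone would not. *)
definition CFL :: "(real \<Rightarrow> real) \<Rightarrow> real \<Rightarrow> real \<Rightarrow> bool" where
  "CFL \<alpha> \<tau> h \<longleftrightarrow> (\<forall>u. 0 \<le> \<tau> / h * deriv \<alpha> u \<and> \<tau> / h * deriv \<alpha> u \<le> 1)"

end

theory Submission
  imports Defs
begin

text \<open>
  For two grid points with inputs \<open>u' \<le> u\<close>, an inversion of the order of the play outputs can only
  shrink during a step. Hence the implicit part of a step does not increase the sum of the absolute
  spatial differences of \<open>a(u)\<close> and of all play components. Under the CFL condition the explicit
  upwind part is total variation diminishing as well, because the flux as a function of \<open>a(u)\<close> has no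
  larger slope than as a function of \<open>u\<close>. For the temporal variation, all components at a grid point
  move in the same direction during a step, so their absolute jumps add up to a flux difference.
\<close>

section \<open>The resolvent of the play\<close>

lemma resolvent_mono:
  assumes "mono \<gamma>r" "mono \<gamma>l" "v \<le> v'" "u \<le> u'"
  shows "resolvent \<gamma>r \<gamma>l v u \<le> resolvent \<gamma>r \<gamma>l v' u'"
  using assms(3) monoD[OF assms(1,4)] monoD[OF assms(2,4)]
  unfolding resolvent_def by (auto simp: min_def max_def)

lemma resolvent_between:
  assumes "\<gamma>r u \<le> \<gamma>l u"
  shows "resolvent \<gamma>r \<gamma>l v u \<in> {\<gamma>r u..\<gamma>l u}"
  using assms unfolding resolvent_def by auto

lemma resolvent_fixed:
  assumes "v \<in> {\<gamma>r u..\<gamma>l u}"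
  shows "resolvent \<gamma>r \<gamma>l v u = v"
  using assms unfolding resolvent_def by auto

text \<open>The output at \<open>u\<close> lies below \<open>\<gamma>l u' \<le> \<gamma>l u\<close>,
  so its upper barrier is inactive and it is at least \<open>v\<close>. The output at
  \<open>u'\<close> then exceeds \<open>\<gamma>r u \<ge> \<gamma>r u'\<close>, so its lower barrier
  is inactive and it is at most \<open>v'\<close>. An inversion is thus inherited from the old
  values, with a gap that has not grown.\<close>

lemma resolvent_inverted_order:
  assumes "mono \<gamma>r" "mono \<gamma>l" "u' \<le> u"
    and "resolvent \<gamma>r \<gamma>l v u < resolvent \<gamma>r \<gamma>l v' u'"
  shows "v \<le> resolvent \<gamma>r \<gamma>l v u" "resolvent \<gamma>r \<gamma>l v' u' \<le> v'"
  using assms(4) monoD[OF assms(1,3)] monoD[OF assms(2,3)]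
  unfolding resolvent_def by (auto simp: min_def max_def split: if_splits)

lemma continuous_on_resolvent:
  assumes "continuous_on UNIV \<gamma>r" "continuous_on UNIV \<gamma>l"
  shows "continuous_on UNIV (resolvent \<gamma>r \<gamma>l v)"
  unfolding resolvent_def by (intro continuous_intros assms)

text \<open>For an inverted pair, \<open>f v \<le> w \<le> w' \<le> f v'\<close> makes the left side
  nonpositive and the right side nonnegative. Otherwise \<open>w - w'\<close> is its own absolute
  value. The right side is free of absolute values, so it can be summed over the components before
  it is paired with \<open>a\<close>.\<close>

lemma resolvent_diff_le:
  fixes f :: "real \<Rightarrow> real" and v v' u u' :: real
  assumes "mono f" "mono \<gamma>r" "mono \<gamma>l" "u' \<le> u"
  defines "w \<equiv> f (resolvent \<gamma>r \<gamma>l v u)" and "w' \<equiv> f (resolvent \<gamma>r \<gamma>l v' u')"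
  shows "\<bar>w - w'\<bar> - \<bar>f v - f v'\<bar> \<le> (w - f v) - (w' - f v')"
proof (cases "resolvent \<gamma>r \<gamma>l v u < resolvent \<gamma>r \<gamma>l v' u'")
  case True
  note inv = resolvent_inverted_order[OF assms(2-4) True]
  have "f v \<le> w" "w' \<le> f v'" "w \<le> w'"
    unfolding w_def w'_def using True inv by (auto intro!: monoD[OF assms(1)])
  then show ?thesis by linarith
next
  case False
  then have "w' \<le> w"
    unfolding w_def w'_def by (intro monoD[OF assms(1)]) simp
  then show ?thesis by linarith
qed

text \<open>With \<open>u' \<le> u\<close>, the difference of \<open>a\<close> is nonnegative and
  the bounds of \<open>resolvent_diff_le\<close> add to it; only the total is then replaced by its
  absolute value. That total is a difference of the quantity, \<open>a\<close> plus play increments,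
  which the scheme prescribes explicitly from the old level.\<close>

lemma implicit_step_contraction:
  fixes c \<gamma>r \<gamma>l :: "'k::finite \<Rightarrow> real \<Rightarrow> real" and v v' :: "'k \<Rightarrow> real" and u u' :: real
  assumes "mono a" and c: "\<And>k. mono (c k)" and \<gamma>: "\<And>k. mono (\<gamma>r k)" "\<And>k. mono (\<gamma>l k)"
  defines "w k \<equiv> c k (resolvent (\<gamma>r k) (\<gamma>l k) (v k) u)"
    and "w' k \<equiv> c k (resolvent (\<gamma>r k) (\<gamma>l k) (v' k) u')"
  shows "\<bar>a u - a u'\<bar> + (\<Sum>k\<in>UNIV. \<bar>w k - w' k\<bar>)
    \<le> \<bar>(a u + (\<Sum>k\<in>UNIV. w k - c k (v k))) - (a u' + (\<Sum>k\<in>UNIV. w' k - c k (v' k)))\<bar>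
      + (\<Sum>k\<in>UNIV. \<bar>c k (v k) - c k (v' k)\<bar>)"
proof (cases "u' \<le> u")
  case True
  have "(\<Sum>k\<in>UNIV. \<bar>w k - w' k\<bar> - \<bar>c k (v k) - c k (v' k)\<bar>)
      \<le> (\<Sum>k\<in>UNIV. (w k - c k (v k)) - (w' k - c k (v' k)))"
    unfolding w_def w'_def by (intro sum_mono resolvent_diff_le c \<gamma> True)
  with monoD[OF assms(1) True] show ?thesis
    unfolding sum_subtractf by linarith
next
  case False
  then have le: "u \<le> u'" by simp
  have "(\<Sum>k\<in>UNIV. \<bar>w' k - w k\<bar> - \<bar>c k (v' k) - c k (v k)\<bar>)
      \<le> (\<Sum>k\<in>UNIV. (w' k - c k (v' k)) - (w k - c k (v k)))"
    unfolding w_def w'_def by (intro sum_mono resolvent_diff_le c \<gamma> le)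
  then have "(\<Sum>k\<in>UNIV. \<bar>w k - w' k\<bar> - \<bar>c k (v k) - c k (v' k)\<bar>)
      \<le> (\<Sum>k\<in>UNIV. (w' k - c k (v' k)) - (w k - c k (v k)))"
    by (simp add: abs_minus_commute)
  with monoD[OF assms(1) le] show ?thesis
    unfolding sum_subtractf by linarith
qed

text \<open>An admissible \<open>v\<close> is a fixed point of the resolvent at \<open>u\<close>, so
  monotonicity in the input gives every increment the sign of the increment of
  \<open>a\<close>.\<close>

lemma resolvent_jump:
  fixes c \<gamma>r \<gamma>l :: "'k::finite \<Rightarrow> real \<Rightarrow> real" and v :: "'k \<Rightarrow> real" and u u' :: real
  assumes "mono a" and c: "\<And>k. mono (c k)" and \<gamma>: "\<And>k. mono (\<gamma>r k)" "\<And>k. mono (\<gamma>l k)"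
    and v: "\<And>k. v k \<in> {\<gamma>r k u..\<gamma>l k u}"
  defines "w k \<equiv> c k (resolvent (\<gamma>r k) (\<gamma>l k) (v k) u')"
  shows "\<bar>a u' - a u\<bar> + (\<Sum>k\<in>UNIV. \<bar>w k - c k (v k)\<bar>)
    = \<bar>(a u' - a u) + (\<Sum>k\<in>UNIV. w k - c k (v k))\<bar>"
proof -
  have fixed: "resolvent (\<gamma>r k) (\<gamma>l k) (v k) u = v k" for k
    by (rule resolvent_fixed) (rule v)
  show ?thesis
  proof (cases "u \<le> u'")
    case True
    have "c k (v k) \<le> w k" for k
      using resolvent_mono[OF \<gamma>(1)[of k] \<gamma>(2)[of k] order_refl True, of "v k"] fixed[of k]
      unfolding w_def by (auto intro!: monoD[OF c])
    moreover have "0 \<le> (\<Sum>k\<in>UNIV. w k - c k (v k))"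
      using calculation by (simp add: sum_nonneg)
    ultimately show ?thesis using monoD[OF assms(1) True] by simp
  next
    case False
    then have le: "u' \<le> u" by simp
    have w: "w k \<le> c k (v k)" for k
      using resolvent_mono[OF \<gamma>(1)[of k] \<gamma>(2)[of k] order_refl le, of "v k"] fixed[of k]
      unfolding w_def by (auto intro!: monoD[OF c])
    have "(\<Sum>k\<in>UNIV. w k - c k (v k)) \<le> 0"
      using w by (simp add: sum_nonpos)
    moreover have "(\<Sum>k\<in>UNIV. \<bar>w k - c k (v k)\<bar>) = - (\<Sum>k\<in>UNIV. w k - c k (v k))"
      using w by (simp add: sum_negf[symmetric])
    ultimately show ?thesis using monoD[OF assms(1) le] by simp
  qed
qed

section \<open>Flux differences and sums over the grid\<close>

lemma diff_between_of_deriv_between: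
  fixes f :: "real \<Rightarrow> real"
  assumes "\<And>x. f differentiable (at x)" "\<And>x. 0 \<le> deriv f x" "\<And>x. deriv f x \<le> L" "x \<le> y"
  shows "0 \<le> f y - f x" "f y - f x \<le> L * (y - x)"
proof -
  have "0 \<le> f y - f x \<and> f y - f x \<le> L * (y - x)"
  proof (cases "x = y")
    case False
    then have "x < y" using assms(4) by simp
    moreover have "(f has_real_derivative deriv f z) (at z)" for z
      using assms(1) by (simp add: DERIV_deriv_iff_real_differentiable)
    ultimately obtain z where "f y - f x = (y - x) * deriv f z"
      using MVT2[of x y f "deriv f"] by blast
    then show ?thesis
      using assms(2,3)[of z] assms(4) by (simp add: mult.commute mult_right_mono)
  qed simp
  then show "0 \<le> f y - f x" "f y - f x \<le> L * (y - x)" by auto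
qed

section \<open>Sums over the integer grid with values in \<open>ennreal\<close>\<close>

lemma ennreal_summable_on: "f summable_on A" for f :: "'i \<Rightarrow> ennreal"
  by (rule nonneg_summable_on_complete) (rule zero_le)

lemma infsum_sum_ennreal:
  fixes f :: "'k \<Rightarrow> 'i \<Rightarrow> ennreal"
  shows "(\<Sum>\<^sub>\<infinity>i\<in>I. \<Sum>k\<in>K. f k i) = (\<Sum>k\<in>K. \<Sum>\<^sub>\<infinity>i\<in>I. f k i)"
  by (induction K rule: infinite_finite_induct)
    (simp_all add: infsum_add[OF ennreal_summable_on ennreal_summable_on])

text \<open>Read \<open>e j\<close> as an amount leaving cell \<open>j\<close> and arriving in cell
  \<open>j + 1\<close>: a translation of the grid balances losses and gains. By
  \<open>e j \<le> s j\<close> the subtraction stays among nonnegative reals, so no infinite totals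
  are cancelled.\<close>

lemma infsum_ennreal_telescope:
  fixes s t e :: "int \<Rightarrow> real"
  assumes e: "\<And>j. 0 \<le> e j" "\<And>j. e j \<le> s j" and t: "\<And>j. t j \<le> s j - e j + e (j - 1)"
  shows "(\<Sum>\<^sub>\<infinity>j\<in>UNIV. ennreal (t j)) \<le> (\<Sum>\<^sub>\<infinity>j\<in>UNIV. ennreal (s j))"
proof -
  have shift: "(\<Sum>\<^sub>\<infinity>j\<in>UNIV. ennreal (e (j - 1))) = (\<Sum>\<^sub>\<infinity>j\<in>UNIV. ennreal (e j))"
    by (rule infsum_reindex_bij_betw) (rule bij_betw_byWitness[of _ "\<lambda>j. j + 1"], auto)
  have "(\<Sum>\<^sub>\<infinity>j\<in>UNIV. ennreal (t j))
      \<le> (\<Sum>\<^sub>\<infinity>j\<in>UNIV. ennreal (s j - e j) + ennreal (e (j - 1)))"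
    using e t by (intro infsum_mono ennreal_summable_on)
      (simp add: ennreal_plus[symmetric] ennreal_leI del: ennreal_plus)
  also have "\<dots> = (\<Sum>\<^sub>\<infinity>j\<in>UNIV. ennreal (s j - e j)) + (\<Sum>\<^sub>\<infinity>j\<in>UNIV. ennreal (e j))"
    by (simp add: infsum_add[OF ennreal_summable_on ennreal_summable_on] shift)
  also have "\<dots> = (\<Sum>\<^sub>\<infinity>j\<in>UNIV. ennreal (s j - e j) + ennreal (e j))"
    by (rule infsum_add[OF ennreal_summable_on ennreal_summable_on, symmetric])
  also have "\<dots> = (\<Sum>\<^sub>\<infinity>j\<in>UNIV. ennreal (s j))"
    using e by (simp add: ennreal_plus[symmetric] del: ennreal_plus)
  finally show ?thesis .
qed

lemma infsum_cmult_right_ennreal: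
  fixes f :: "'i \<Rightarrow> ennreal"
  assumes "c < top"
  shows "(\<Sum>\<^sub>\<infinity>i\<in>I. c * f i) = c * (\<Sum>\<^sub>\<infinity>i\<in>I. f i)"
proof -
  have "(f has_sum infsum f I) I"
    by (rule has_sum_infsum[OF ennreal_summable_on])
  then have "((\<lambda>i. c * f i) has_sum c * infsum f I) I"
    unfolding has_sum_def sum_distrib_left[symmetric] by (rule ennreal_tendsto_cmult[OF assms])
  then show ?thesis by (rule infsumI)
qed

text \<open>Any finite set of cells sits in a symmetric window, whose endpoints form an increasing
  chain to which \<open>M\<close> applies.\<close>

lemma infsum_grid_variation_le:
  fixes f :: "real \<Rightarrow> real"
  assumes M: "\<And>(p :: nat \<Rightarrow> real) m. mono p \<Longrightarrow> (\<Sum>i<m. \<bar>f (p (Suc i)) - f (p i)\<bar>) \<le> M"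
    and "h > 0"
  shows "(\<Sum>\<^sub>\<infinity>j\<in>UNIV. ennreal \<bar>f (of_int (j + 1) * h) - f (of_int j * h)\<bar>) \<le> ennreal M"
proof (rule infsum_le_finite_sums)
  let ?d = "\<lambda>j::int. \<bar>f (of_int (j + 1) * h) - f (of_int j * h)\<bar>"
  show "(\<lambda>j. ennreal (?d j)) summable_on UNIV"
    by (rule ennreal_summable_on)
  fix F :: "int set" assume "finite F" "F \<subseteq> UNIV"
  \<comment> \<open>Inserting 0 keeps the maximum meaningful for empty \<open>F\<close>. The window
    from \<open>-m\<close> to \<open>m\<close> has \<open>2 * m + 1\<close> cells, and
    \<open>p\<close> runs through their endpoints.\<close>
  define m where "m = nat (Max (insert 0 (abs ` F)))"
  define p where "p i = (of_int (int i - int m) * h)" for i :: nat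
  have "\<bar>j\<bar> \<le> Max (insert 0 (abs ` F))" if "j \<in> F" for j
    using \<open>finite F\<close> that by (intro Max_ge) auto
  then have "F \<subseteq> {- int m..int m}"
    unfolding m_def by (fastforce simp: abs_le_iff)
  then have "(\<Sum>j\<in>F. ?d j) \<le> (\<Sum>j\<in>{- int m..int m}. ?d j)"
    by (intro sum_mono2) auto
  also have "\<dots> = (\<Sum>i<2 * m + 1. ?d (int i - int m))"
    by (rule sum.reindex_bij_witness[of _ "\<lambda>i. int i - int m" "\<lambda>j. nat (j + int m)"]) auto
  also have "\<dots> = (\<Sum>i<2 * m + 1. \<bar>f (p (Suc i)) - f (p i)\<bar>)"
    unfolding p_def by (simp add: algebra_simps)
  also have "mono p"
    unfolding p_def using \<open>h > 0\<close> by (auto intro!: monoI)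
  then have "(\<Sum>i<2 * m + 1. \<bar>f (p (Suc i)) - f (p i)\<bar>) \<le> M"
    by (rule M)
  finally show "(\<Sum>j\<in>F. ennreal (?d j)) \<le> ennreal M"
    by (simp add: sum_ennreal ennreal_leI)
qed

section \<open>The upwind scheme\<close>

lemma strongly_monotone_bijective:
  fixes g :: "real \<Rightarrow> real"
  assumes "continuous_on UNIV g" and slope: "\<And>x x'. x \<le> x' \<Longrightarrow> x' - x \<le> g x' - g x"
  shows "\<exists>!x. g x = y"
proof (rule ex_ex1I)
  have cont: "isCont g x" for x
    using assms(1) by (simp add: continuous_on_eq_continuous_at)
  show "\<exists>x. g x = y"
  proof (cases "g 0 \<le> y")
    case True
    \<comment> \<open>A slope of at least one means that moving from 0 by the residual
      \<open>y - g 0\<close> reaches or passes the target; this is the second end of the bracket.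
      The other case is its mirror image.\<close>
    then have "y \<le> g (y - g 0)"
      using slope[of 0 "y - g 0"] by simp
    then show ?thesis
      using IVT[of g 0 y "y - g 0"] True cont by auto
  next
    case False
    then have "g (y - g 0) \<le> y"
      using slope[of "y - g 0" 0] by simp
    then show ?thesis
      using IVT[of g "y - g 0" y 0] False cont by auto
  qed
  fix x x' assume "g x = y" "g x' = y"
  then show "x = x'"
    using slope[of x x'] slope[of x' x] by linarith
qed

text \<open>Fixes a single discretization. All admissible shapes of \<open>b\<close> are treated at
  once through continuity and monotonicity.\<close>

locale upwind_scheme =
  fixes a a0 \<alpha> uinit :: "real \<Rightarrow> real" and \<mu> :: "'k::finite \<Rightarrow> real"
    and b \<gamma>r \<gamma>l vinit :: "'k \<Rightarrow> real \<Rightarrow> real" and \<tau> h :: real and N :: nat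
  assumes a_eq: "\<And>u. a u = u + a0 u"
    and a0: "continuous_on UNIV a0" "mono a0"
    and \<alpha>_diff: "\<And>u. \<alpha> differentiable (at u)"
    and \<mu>_pos: "\<And>k. \<mu> k > 0"
    and \<gamma>r: "\<And>k. continuous_on UNIV (\<gamma>r k)" "\<And>k. mono (\<gamma>r k)"
    and \<gamma>l: "\<And>k. continuous_on UNIV (\<gamma>l k)" "\<And>k. mono (\<gamma>l k)"
    and \<gamma>_le: "\<And>k u. \<gamma>r k u \<le> \<gamma>l k u"
    and b: "\<And>k. continuous_on UNIV (b k)" "\<And>k. mono (b k)"
    and vinit: "\<And>k x. vinit k x \<in> {\<gamma>r k (uinit x)..\<gamma>l k (uinit x)}"
    and \<tau>_pos: "\<tau> > 0" and h_pos: "h > 0" and CFL: "CFL \<alpha> \<tau> h"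
begin

lemma a_expansive: "u \<le> u' \<Longrightarrow> u' - u \<le> a u' - a u"
  using monoD[OF a0(2), of u u'] by (simp add: a_eq)

lemma mono_a: "mono a"
  using a_expansive by (intro monoI) (smt (verit))

lemma mono_weighted_b: "mono (\<lambda>x. \<mu> k * b k x)"
  using \<mu>_pos[of k] monoD[OF b(2)] by (intro monoI mult_left_mono) auto

lemma deriv_\<alpha>: "0 \<le> deriv \<alpha> u" "\<tau> / h * deriv \<alpha> u \<le> 1"
proof -
  have "0 \<le> \<tau> / h * deriv \<alpha> u" "0 < \<tau> / h"
    using CFL \<tau>_pos h_pos unfolding CFL_def by auto
  then show "0 \<le> deriv \<alpha> u"
    by (simp only: zero_le_mult_iff) linarith
  show "\<tau> / h * deriv \<alpha> u \<le> 1"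
    using CFL unfolding CFL_def by auto
qed

text \<open>As \<open>a\<close> expands distances, the flux as a function of \<open>a u\<close>
  inherits the slope bound \<open>L\<close>. It serves twice: with \<open>L = h / \<tau>\<close> for
  the CFL estimate, and with a bound independent of the grid for the jumps in time.\<close>

lemma flux_diff_le:
  assumes "\<And>u. deriv \<alpha> u \<le> L"
  shows "\<bar>\<alpha> u - \<alpha> u'\<bar> \<le> L * \<bar>a u - a u'\<bar>"
proof -
  have L: "0 \<le> L" using deriv_\<alpha>(1)[of 0] assms[of 0] by simp
  have "\<bar>\<alpha> y - \<alpha> x\<bar> \<le> L * \<bar>a y - a x\<bar>" if "x \<le> y" for x y
  proof -
    note D = diff_between_of_deriv_between[OF \<alpha>_diff deriv_\<alpha>(1) assms that]
    have "L * (y - x) \<le> L * (a y - a x)"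
      using a_expansive[OF that] L by (rule mult_left_mono)
    then show ?thesis using D monoD[OF mono_a that] by simp
  qed
  then show ?thesis
    using linear[of u u'] by (metis abs_minus_commute)
qed

text \<open>Both \<open>a\<close> and \<open>\<alpha>\<close> are nondecreasing, so their
  differences share a sign; by the first claim the subtraction does not reverse it.\<close>

lemma CFL_flux_abs:
  "\<tau> / h * \<bar>\<alpha> u - \<alpha> u'\<bar> \<le> \<bar>a u - a u'\<bar>"
  "\<bar>(a u - a u') - \<tau> / h * (\<alpha> u - \<alpha> u')\<bar> = \<bar>a u - a u'\<bar> - \<tau> / h * \<bar>\<alpha> u - \<alpha> u'\<bar>"
proof -
  have L: "deriv \<alpha> v \<le> h / \<tau>" for v
    using deriv_\<alpha>(2)[of v] \<tau>_pos h_pos by (simp add: field_simps)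
  have "\<tau> / h * \<bar>\<alpha> u - \<alpha> u'\<bar> \<le> \<tau> / h * (h / \<tau> * \<bar>a u - a u'\<bar>)"
    using flux_diff_le[OF L] \<tau>_pos h_pos by (intro mult_left_mono) auto
  also have "\<dots> = \<bar>a u - a u'\<bar>"
    using \<tau>_pos h_pos by simp
  finally show le: "\<tau> / h * \<bar>\<alpha> u - \<alpha> u'\<bar> \<le> \<bar>a u - a u'\<bar>" .
  have signs: "(u \<le> u' \<longrightarrow> \<alpha> u \<le> \<alpha> u' \<and> a u \<le> a u') \<and> (u' \<le> u \<longrightarrow> \<alpha> u' \<le> \<alpha> u \<and> a u' \<le> a u)"
    using diff_between_of_deriv_between(1)[OF \<alpha>_diff deriv_\<alpha>(1) L] monoD[OF mono_a] by force
  show "\<bar>(a u - a u') - \<tau> / h * (\<alpha> u - \<alpha> u')\<bar> = \<bar>a u - a u'\<bar> - \<tau> / h * \<bar>\<alpha> u - \<alpha> u'\<bar>"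
  proof (cases "u' \<le> u")
    case True
    then show ?thesis using signs le by simp
  next
    case False
    then have "\<bar>\<alpha> u - \<alpha> u'\<bar> = - (\<alpha> u - \<alpha> u')" "\<bar>a u - a u'\<bar> = - (a u - a u')"
      using signs by auto
    then show ?thesis using le by (simp only: mult_minus_right)
  qed
qed

section \<open>Unique solvability of the scheme\<close>

lemma implicit_step_solvable:
  "\<exists>!u. a u + (\<Sum>k\<in>UNIV. \<mu> k * b k (resolvent (\<gamma>r k) (\<gamma>l k) (v k) u)) = y"
proof (rule strongly_monotone_bijective)
  have cont: "continuous_on UNIV (\<lambda>u. b k (resolvent (\<gamma>r k) (\<gamma>l k) (v k) u))" for k
    by (rule continuous_on_compose2[OF b(1) continuous_on_resolvent[OF \<gamma>r(1) \<gamma>l(1)]]) auto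
  show "continuous_on UNIV (\<lambda>u. a u + (\<Sum>k\<in>UNIV. \<mu> k * b k (resolvent (\<gamma>r k) (\<gamma>l k) (v k) u)))"
    unfolding a_eq by (intro continuous_intros cont a0(1))
  fix u u' :: real assume le: "u \<le> u'"
  \<comment> \<open>The play terms are nondecreasing in the input, so they preserve the unit slope
    supplied by \<open>a\<close>.\<close>
  have "(\<Sum>k\<in>UNIV. \<mu> k * b k (resolvent (\<gamma>r k) (\<gamma>l k) (v k) u))
      \<le> (\<Sum>k\<in>UNIV. \<mu> k * b k (resolvent (\<gamma>r k) (\<gamma>l k) (v k) u'))"
    by (intro sum_mono monoD[OF mono_weighted_b] resolvent_mono \<gamma>r \<gamma>l le order_refl)
  then show "u' - u \<le> a u' + (\<Sum>k\<in>UNIV. \<mu> k * b k (resolvent (\<gamma>r k) (\<gamma>l k) (v k) u'))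
      - (a u + (\<Sum>k\<in>UNIV. \<mu> k * b k (resolvent (\<gamma>r k) (\<gamma>l k) (v k) u)))"
    using a_expansive[OF le] by linarith
qed

abbreviation is_solution where
  "is_solution \<equiv> upwind_solution a \<alpha> \<mu> b \<gamma>r \<gamma>l uinit vinit \<tau> h N"

lemma scheme_eq_iff:
  "1 / \<tau> * (A - A' + w - w') + 1 / h * d = 0 \<longleftrightarrow> A + w = A' + w' - \<tau> / h * d"
  using \<tau>_pos h_pos by (auto simp: field_simps)

lemma solution_exists: "\<exists>U V W. is_solution U V W"
proof -
  \<comment> \<open>A state is a whole time level: at each gridpoint the value of \<open>U\<close>
    and the vector of play states. \<open>W\<close> is recovered from the latter.\<close>
  define upd where "upd s s' \<longleftrightarrow> (\<forall>j.
      a (fst (s' j)) + (\<Sum>k\<in>UNIV. \<mu> k * b k (resolvent (\<gamma>r k) (\<gamma>l k) (snd (s j) k) (fst (s' j))))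
        = a (fst (s j)) + (\<Sum>k\<in>UNIV. \<mu> k * b k (snd (s j) k))
          - \<tau> / h * (\<alpha> (fst (s j)) - \<alpha> (fst (s (j - 1)))) \<and>
      snd (s' j) = (\<lambda>k. resolvent (\<gamma>r k) (\<gamma>l k) (snd (s j) k) (fst (s' j))))"
    for s s' :: "int \<Rightarrow> real \<times> ('k \<Rightarrow> real)"
  define s0 where "s0 j = (uinit (of_int j * h), \<lambda>k. vinit k (of_int j * h))" for j :: int
  \<comment> \<open>The flux involves the old level only, so the gridpoints decouple and the new
    values can be chosen pointwise.\<close>
  have "\<exists>s'. upd s s'" for s
    unfolding upd_def
    by (rule choice) (use implicit_step_solvable in fastforce)
  then obtain S where S: "S 0 = s0" "\<And>n. upd (S n) (S (Suc n))"
    using dependent_nat_choice[of "\<lambda>n s. n = 0 \<longrightarrow> s = s0" "\<lambda>_. upd"] by auto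
  have "is_solution (\<lambda>n j. fst (S n j)) (\<lambda>k n j. snd (S n j) k)
      (\<lambda>n j. \<Sum>k\<in>UNIV. \<mu> k * b k (snd (S n j) k))"
    unfolding upwind_solution_def
  proof (intro conjI ballI allI)
    fix n j assume "n \<in> {1..N}"
    then have u: "upd (S (n - 1)) (S n)"
      using S(2)[of "n - 1"] by simp
    then have V: "snd (S n j) = (\<lambda>k. resolvent (\<gamma>r k) (\<gamma>l k) (snd (S (n - 1) j) k) (fst (S n j)))"
      unfolding upd_def by auto
    show "snd (S n j) k = resolvent (\<gamma>r k) (\<gamma>l k) (snd (S (n - 1) j) k) (fst (S n j))" for k
      using V by metis
    show "(\<Sum>k\<in>UNIV. \<mu> k * b k (snd (S n j) k))
        = (\<Sum>k\<in>UNIV. \<mu> k * b k (resolvent (\<gamma>r k) (\<gamma>l k) (snd (S (n - 1) j) k) (fst (S n j))))"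
      by (simp add: V)
    show "1 / \<tau> * (a (fst (S n j)) - a (fst (S (n - 1) j))
          + (\<Sum>k\<in>UNIV. \<mu> k * b k (snd (S n j) k)) - (\<Sum>k\<in>UNIV. \<mu> k * b k (snd (S (n - 1) j) k)))
        + 1 / h * (\<alpha> (fst (S (n - 1) j)) - \<alpha> (fst (S (n - 1) (j - 1)))) = 0"
      using u unfolding scheme_eq_iff V upd_def by auto
  qed (simp_all add: S(1) s0_def)
  then show ?thesis by blast
qed

lemma solution_W:
  assumes "is_solution U V W" "n \<le> N"
  shows "W n j = (\<Sum>k\<in>UNIV. \<mu> k * b k (V k n j))"
  using assms unfolding upwind_solution_def by (cases n) auto

lemma solution_V:
  assumes "is_solution U V W" "n < N"
  shows "V k (Suc n) j = resolvent (\<gamma>r k) (\<gamma>l k) (V k n j) (U (Suc n) j)"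
proof -
  have "Suc n \<in> {1..N}" using assms(2) by auto
  with assms(1) show ?thesis unfolding upwind_solution_def by fastforce
qed

lemma solution_step:
  assumes "is_solution U V W" "n < N"
  shows "a (U (Suc n) j) + W (Suc n) j
    = a (U n j) + W n j - \<tau> / h * (\<alpha> (U n j) - \<alpha> (U n (j - 1)))"
proof -
  have "Suc n \<in> {1..N}" using assms(2) by auto
  with assms(1) show ?thesis unfolding upwind_solution_def scheme_eq_iff by fastforce
qed

text \<open>The induction keeps \<open>j\<close> arbitrary because the new value at \<open>j\<close>
  draws on the old ones at \<open>j\<close> and \<open>j - 1\<close>.\<close>

lemma solution_unique:
  assumes "is_solution U V W" "is_solution U' V' W'" "n \<le> N"
  shows "U n j = U' n j \<and> W n j = W' n j \<and> (\<forall>k. V k n j = V' k n j)"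
  using assms(3)
proof (induction n arbitrary: j)
  case 0
  show ?case using assms(1,2) unfolding upwind_solution_def by simp
next
  case (Suc n)
  then have n: "n < N" "n \<le> N" by auto
  note IH = Suc.IH[OF n(2)]
  have "U (Suc n) j = U' (Suc n) j"
  proof (rule ex1E[OF implicit_step_solvable])
    fix u assume uniq: "\<forall>y. a y + (\<Sum>k\<in>UNIV. \<mu> k * b k (resolvent (\<gamma>r k) (\<gamma>l k) (V k n j) y))
        = a (U n j) + W n j - \<tau> / h * (\<alpha> (U n j) - \<alpha> (U n (j - 1))) \<longrightarrow> y = u"
    have "U (Suc n) j = u"
      using solution_step[OF assms(1) n(1), of j]
      by (intro uniq[rule_format]) (simp add: solution_W[OF assms(1) Suc.prems] solution_V[OF assms(1) n(1)])
    moreover have "U' (Suc n) j = u"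
      using solution_step[OF assms(2) n(1), of j] IH[of j] IH[of "j - 1"]
      by (intro uniq[rule_format]) (simp add: solution_W[OF assms(2) Suc.prems] solution_V[OF assms(2) n(1)])
    ultimately show ?thesis by simp
  qed
  moreover have "V k (Suc n) j = V' k (Suc n) j" for k
    using calculation IH[of j] by (simp add: solution_V[OF assms(1) n(1)] solution_V[OF assms(2) n(1)])
  ultimately show ?case
    by (simp add: solution_W[OF assms(1) Suc.prems] solution_W[OF assms(2) Suc.prems])
qed

section \<open>Variation estimates in space and time\<close>

lemma solution_V_between:
  assumes "is_solution U V W" "n \<le> N"
  shows "V k n j \<in> {\<gamma>r k (U n j)..\<gamma>l k (U n j)}"
proof (cases n)
  case 0
  then show ?thesis using assms(1) vinit unfolding upwind_solution_def by simp
next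
  case (Suc m)
  then show ?thesis
    using solution_V[OF assms(1), of m] assms(2) resolvent_between[of "\<gamma>r k" "U n j" "\<gamma>l k"] \<gamma>_le
    by simp
qed

lemma spatial_variation_step:
  fixes U :: "nat \<Rightarrow> int \<Rightarrow> real" and V :: "'k \<Rightarrow> nat \<Rightarrow> int \<Rightarrow> real"
  assumes sol: "is_solution U V W" and n: "n < N"
  defines "s m j \<equiv> \<bar>a (U m (j + 1)) - a (U m j)\<bar>
    + (\<Sum>k\<in>UNIV. \<bar>\<mu> k * b k (V k m (j + 1)) - \<mu> k * b k (V k m j)\<bar>)"
  shows "(\<Sum>\<^sub>\<infinity>j\<in>UNIV. ennreal (s (Suc n) j)) \<le> (\<Sum>\<^sub>\<infinity>j\<in>UNIV. ennreal (s n j))"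
proof (rule infsum_ennreal_telescope)
  \<comment> \<open>The variation that the flux transports from the interval right of
    \<open>j\<close> to the next one; CFL caps it by the difference of \<open>a\<close>
    there.\<close>
  define e where "e j = \<tau> / h * \<bar>\<alpha> (U n (j + 1)) - \<alpha> (U n j)\<bar>" for j
  fix j
  show "0 \<le> e j" unfolding e_def using \<tau>_pos h_pos by simp
  have "0 \<le> (\<Sum>k\<in>UNIV. \<bar>\<mu> k * b k (V k n (j + 1)) - \<mu> k * b k (V k n j)\<bar>)"
    by (simp add: sum_nonneg)
  then show "e j \<le> s n j"
    unfolding e_def s_def using CFL_flux_abs(1)[of "U n (j + 1)" "U n j"] by linarith
  \<comment> \<open>The scheme arranged so that its left side is the quantity compared in
    \<open>implicit_step_contraction\<close>.\<close>
  have F: "a (U (Suc n) i) + (\<Sum>k\<in>UNIV. \<mu> k * b k (V k (Suc n) i) - \<mu> k * b k (V k n i))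
      = a (U n i) - \<tau> / h * (\<alpha> (U n i) - \<alpha> (U n (i - 1)))" for i
    using solution_step[OF sol n, of i] n
    by (simp add: solution_W[OF sol] sum_subtractf)
  have "s (Suc n) j \<le>
      \<bar>(a (U (Suc n) (j + 1)) + (\<Sum>k\<in>UNIV. \<mu> k * b k (V k (Suc n) (j + 1)) - \<mu> k * b k (V k n (j + 1))))
        - (a (U (Suc n) j) + (\<Sum>k\<in>UNIV. \<mu> k * b k (V k (Suc n) j) - \<mu> k * b k (V k n j)))\<bar>
      + (\<Sum>k\<in>UNIV. \<bar>\<mu> k * b k (V k n (j + 1)) - \<mu> k * b k (V k n j)\<bar>)"
    unfolding s_def solution_V[OF sol n]
    by (rule implicit_step_contraction[OF mono_a mono_weighted_b \<gamma>r(2) \<gamma>l(2)])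
  also have "\<dots> = \<bar>((a (U n (j + 1)) - a (U n j)) - \<tau> / h * (\<alpha> (U n (j + 1)) - \<alpha> (U n j)))
        + \<tau> / h * (\<alpha> (U n j) - \<alpha> (U n (j - 1)))\<bar>
      + (\<Sum>k\<in>UNIV. \<bar>\<mu> k * b k (V k n (j + 1)) - \<mu> k * b k (V k n j)\<bar>)"
    unfolding F by (simp add: algebra_simps)
  \<comment> \<open>Separates the inflow from the left; \<open>CFL_flux_abs\<close> evaluates the
    remaining absolute value exactly.\<close>
  also have "\<dots> \<le> \<bar>(a (U n (j + 1)) - a (U n j)) - \<tau> / h * (\<alpha> (U n (j + 1)) - \<alpha> (U n j))\<bar>
        + \<bar>\<tau> / h * (\<alpha> (U n j) - \<alpha> (U n (j - 1)))\<bar>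
      + (\<Sum>k\<in>UNIV. \<bar>\<mu> k * b k (V k n (j + 1)) - \<mu> k * b k (V k n j)\<bar>)"
    by (intro add_right_mono abs_triangle_ineq)
  also have "\<dots> = s n j - e j + e (j - 1)"
    unfolding CFL_flux_abs(2) s_def e_def abs_mult using \<tau>_pos h_pos by simp
  finally show "s (Suc n) j \<le> s n j - e j + e (j - 1)" .
qed

text \<open>By \<open>resolvent_jump\<close> the absolute jumps add up to one flux difference, and
  the weight \<open>h\<close> cancels its factor \<open>1 / h\<close>.\<close>

lemma temporal_variation_step:
  assumes sol: "is_solution U V W" and n: "n < N" and L: "\<And>u. deriv \<alpha> u \<le> L"
  shows "h * (\<bar>a (U (Suc n) j) - a (U n j)\<bar>
      + (\<Sum>k\<in>UNIV. \<bar>\<mu> k * b k (V k (Suc n) j) - \<mu> k * b k (V k n j)\<bar>))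
    \<le> \<tau> * L * \<bar>a (U n j) - a (U n (j - 1))\<bar>"
proof -
  have jump: "(a (U (Suc n) j) - a (U n j))
      + (\<Sum>k\<in>UNIV. \<mu> k * b k (V k (Suc n) j) - \<mu> k * b k (V k n j))
    = - (\<tau> / h * (\<alpha> (U n j) - \<alpha> (U n (j - 1))))"
    using solution_step[OF sol n, of j] n
    by (simp add: solution_W[OF sol] sum_subtractf)
  have "h * (\<bar>a (U (Suc n) j) - a (U n j)\<bar>
      + (\<Sum>k\<in>UNIV. \<bar>\<mu> k * b k (V k (Suc n) j) - \<mu> k * b k (V k n j)\<bar>))
    = h * \<bar>(a (U (Suc n) j) - a (U n j))
      + (\<Sum>k\<in>UNIV. \<mu> k * b k (V k (Suc n) j) - \<mu> k * b k (V k n j))\<bar>"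
    unfolding solution_V[OF sol n]
    by (rule arg_cong[OF resolvent_jump])
      (intro mono_a mono_weighted_b \<gamma>r(2) \<gamma>l(2) solution_V_between[OF sol less_imp_le[OF n]])+
  also have "\<dots> = h * \<bar>- (\<tau> / h * (\<alpha> (U n j) - \<alpha> (U n (j - 1))))\<bar>"
    unfolding jump ..
  also have "\<dots> = \<tau> * \<bar>\<alpha> (U n j) - \<alpha> (U n (j - 1))\<bar>"
    using \<tau>_pos h_pos by (simp add: abs_mult)
  also have "\<dots> \<le> \<tau> * (L * \<bar>a (U n j) - a (U n (j - 1))\<bar>)"
    using \<tau>_pos by (intro mult_left_mono flux_diff_le L) simp
  finally show ?thesis by (simp add: mult.assoc)
qed

text \<open>The initial spatial variation bounds that of all later levels. The \<open>Suc N\<close>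
  levels contribute \<open>\<tau>\<close> times this bound each, the \<open>N\<close> time jumps
  \<open>\<tau> * L\<close> times it each.\<close>

lemma TV_T_le:
  assumes sol: "is_solution U V W" and L: "\<And>u. deriv \<alpha> u \<le> L"
    and Ma: "\<And>(p :: nat \<Rightarrow> real) m. mono p \<Longrightarrow>
      (\<Sum>i<m. \<bar>a (uinit (p (Suc i))) - a (uinit (p i))\<bar>) \<le> Ma"
    and Mw: "\<And>k (p :: nat \<Rightarrow> real) m. mono p \<Longrightarrow>
      (\<Sum>i<m. \<bar>\<mu> k * b k (vinit k (p (Suc i))) - \<mu> k * b k (vinit k (p i))\<bar>) \<le> Mw k"
  shows "TV_T \<tau> h N (\<lambda>n j. a (U n j)) (\<lambda>k n j. \<mu> k * b k (V k n j))
    \<le> ennreal (\<tau> * (real (Suc N) + real N * L) * (Ma + (\<Sum>k\<in>UNIV. Mw k)))"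
proof -
  define M where "M = Ma + (\<Sum>k\<in>UNIV. Mw k)"
  define s where "s n j = \<bar>a (U n (j + 1)) - a (U n j)\<bar>
    + (\<Sum>k\<in>UNIV. \<bar>\<mu> k * b k (V k n (j + 1)) - \<mu> k * b k (V k n j)\<bar>)" for n j
  \<comment> \<open>Chains of length zero show that \<open>Ma\<close> and \<open>Mw\<close> are
    nonnegative.\<close>
  have nonneg: "0 \<le> L" "0 \<le> Ma" "\<And>k. 0 \<le> Mw k"
    using deriv_\<alpha>(1)[of 0] L[of 0] Ma[of "\<lambda>_. 0" 0] Mw[of "\<lambda>_. 0" _ 0] by (auto simp: mono_def)
  then have M: "0 \<le> M" by (simp add: M_def sum_nonneg)
  have space: "(\<Sum>\<^sub>\<infinity>j\<in>UNIV. ennreal (s n j)) \<le> ennreal M" if "n \<le> N" for n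
    using that
  proof (induction n)
    case 0
    have U0: "U 0 j = uinit (of_int j * h)" "V k 0 j = vinit k (of_int j * h)" for j k
      using sol unfolding upwind_solution_def by auto
    have "(\<Sum>\<^sub>\<infinity>j\<in>UNIV. ennreal (s 0 j))
      = (\<Sum>\<^sub>\<infinity>j\<in>UNIV. ennreal \<bar>a (U 0 (j + 1)) - a (U 0 j)\<bar>
          + (\<Sum>k\<in>UNIV. ennreal \<bar>\<mu> k * b k (V k 0 (j + 1)) - \<mu> k * b k (V k 0 j)\<bar>))"
      unfolding s_def by (simp add: sum_nonneg)
    also have "\<dots> = (\<Sum>\<^sub>\<infinity>j\<in>UNIV. ennreal \<bar>a (U 0 (j + 1)) - a (U 0 j)\<bar>)
        + (\<Sum>k\<in>UNIV. \<Sum>\<^sub>\<infinity>j\<in>UNIV. ennreal \<bar>\<mu> k * b k (V k 0 (j + 1)) - \<mu> k * b k (V k 0 j)\<bar>)"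
      by (simp add: infsum_add[OF ennreal_summable_on ennreal_summable_on] infsum_sum_ennreal
          del: sum_ennreal)
    also have "\<dots> \<le> ennreal Ma + (\<Sum>k\<in>UNIV. ennreal (Mw k))"
      unfolding U0
      by (intro add_mono sum_mono infsum_grid_variation_le[of "\<lambda>x. a (uinit x)"]
          infsum_grid_variation_le[of "\<lambda>x. \<mu> k * b k (vinit k x)" for k] Ma Mw h_pos)
    also have "\<dots> = ennreal M"
      unfolding M_def using nonneg by (simp add: sum_nonneg)
    finally show ?case .
  next
    case (Suc n)
    then show ?case
      using spatial_variation_step[OF sol, of n] unfolding s_def by (auto intro: order_trans)
  qed
  have time: "ennreal h * (\<Sum>\<^sub>\<infinity>j\<in>UNIV. ennreal (\<bar>a (U (n + 1) j) - a (U n j)\<bar>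
      + (\<Sum>k\<in>UNIV. \<bar>\<mu> k * b k (V k (n + 1) j) - \<mu> k * b k (V k n j)\<bar>))) \<le> ennreal (\<tau> * L * M)"
    (is "_ * infsum (\<lambda>j. ennreal (?t j)) UNIV \<le> _") if n: "n < N" for n
  proof -
    have "ennreal h * (\<Sum>\<^sub>\<infinity>j\<in>UNIV. ennreal (?t j)) = (\<Sum>\<^sub>\<infinity>j\<in>UNIV. ennreal (h * ?t j))"
      using h_pos by (simp add: infsum_cmult_right_ennreal ennreal_mult' sum_nonneg)
    \<comment> \<open>The upwind jump at \<open>j\<close> is controlled by the interval from
      \<open>j - 1\<close> to \<open>j\<close>, hence the shifted index.\<close>
    also have "\<dots> \<le> (\<Sum>\<^sub>\<infinity>j\<in>UNIV. ennreal (\<tau> * L) * ennreal (s n (j - 1)))"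
    proof (intro infsum_mono ennreal_summable_on)
      fix j :: int
      have "h * ?t j \<le> \<tau> * L * s n (j - 1)"
      proof -
        have "h * ?t j \<le> \<tau> * L * \<bar>a (U n j) - a (U n (j - 1))\<bar>"
          using temporal_variation_step[OF sol n L, of j] by simp
        also have "\<dots> \<le> \<tau> * L * s n (j - 1)"
          unfolding s_def using \<tau>_pos nonneg by (intro mult_left_mono) (auto intro: sum_nonneg)
        finally show ?thesis .
      qed
      then show "ennreal (h * ?t j) \<le> ennreal (\<tau> * L) * ennreal (s n (j - 1))"
        using \<tau>_pos nonneg by (simp add: ennreal_mult'[symmetric] ennreal_leI)
    qed
    also have "\<dots> = ennreal (\<tau> * L) * (\<Sum>\<^sub>\<infinity>j\<in>UNIV. ennreal (s n (j - 1)))"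
      by (simp add: infsum_cmult_right_ennreal)
    also have "(\<Sum>\<^sub>\<infinity>j\<in>UNIV. ennreal (s n (j - 1))) = (\<Sum>\<^sub>\<infinity>j\<in>UNIV. ennreal (s n j))"
      by (rule infsum_reindex_bij_betw) (rule bij_betw_byWitness[of _ "\<lambda>j. j + 1"], auto)
    also have "ennreal (\<tau> * L) * \<dots> \<le> ennreal (\<tau> * L) * ennreal M"
      using n by (intro mult_left_mono space) auto
    also have "\<dots> = ennreal (\<tau> * L * M)"
      using \<tau>_pos nonneg M by (simp add: ennreal_mult)
    finally show ?thesis .
  qed
  have "TV_T \<tau> h N (\<lambda>n j. a (U n j)) (\<lambda>k n j. \<mu> k * b k (V k n j))
      \<le> (\<Sum>n\<le>N. ennreal \<tau> * ennreal M) + (\<Sum>n<N. ennreal (\<tau> * L * M))"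
    unfolding TV_T_def s_def[symmetric]
    by (intro add_mono sum_mono mult_left_mono space time) auto
  also have "ennreal \<tau> * ennreal M = ennreal (\<tau> * M)"
    using \<tau>_pos M by (simp add: ennreal_mult)
  also have "(\<Sum>n\<le>N. ennreal (\<tau> * M)) + (\<Sum>n<N. ennreal (\<tau> * L * M))
      = ennreal ((\<Sum>n\<le>N. \<tau> * M) + (\<Sum>n<N. \<tau> * L * M))"
    using \<tau>_pos nonneg M by (subst (1 2) sum_ennreal) (simp_all add: ennreal_plus)
  also have "(\<Sum>n\<le>N. \<tau> * M) + (\<Sum>n<N. \<tau> * L * M) = \<tau> * (real (Suc N) + real N * L) * M"
    by (simp add: algebra_simps)
  finally show ?thesis unfolding M_def .
qed

end

text \<open>\<open>C\<close> is chosen before \<open>T\<close>, \<open>\<tau>\<close>,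
  \<open>h\<close> and \<open>N\<close>, which expresses uniformity in the grid. Bounded variation
  is asked of the initial values of the very components that \<open>TV_T\<close> measures.\<close>

theorem proposition3:
  fixes a a0 \<alpha> uinit :: "real \<Rightarrow> real"
    and \<mu> hb :: "'k::finite \<Rightarrow> real"
    and b \<gamma>r \<gamma>l vinit :: "'k \<Rightarrow> real \<Rightarrow> real"
    and \<epsilon> :: real
  assumes a_eq: "\<And>u. a u = u + a0 u"
    and a0: "continuous_on UNIV a0" "mono a0"
    and \<alpha>_diff: "\<And>u. \<alpha> differentiable (at u)"
    and \<mu>_pos: "\<And>k. \<mu> k > 0"
    and \<gamma>r: "\<And>k. continuous_on UNIV (\<gamma>r k)" "\<And>k. mono (\<gamma>r k)"
    and \<gamma>l: "\<And>k. continuous_on UNIV (\<gamma>l k)" "\<And>k. mono (\<gamma>l k)"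
    and \<gamma>_le: "\<And>k u. \<gamma>r k u \<le> \<gamma>l k u"
    and hb_pos: "\<And>k. hb k > 0"
    and \<epsilon>_pos: "\<epsilon> > 0"
    and b: "\<And>k. play_output (hb k) \<epsilon> (b k)"
    and vinit: "\<And>k x. vinit k x \<in> {\<gamma>r k (uinit x)..\<gamma>l k (uinit x)}"
    and bv_a: "bounded_variation (\<lambda>x. a (uinit x))"
    and bv_w: "\<And>k. bounded_variation (\<lambda>x. \<mu> k * b k (vinit k x))"
  shows "\<exists>C :: real \<Rightarrow> real.
    \<forall>T \<tau> h :: real. \<forall>N :: nat. T > 0 \<and> N \<ge> 1 \<and> \<tau> = T / real N \<and> h > 0 \<and> CFL \<alpha> \<tau> h \<longrightarrow>
      (\<exists>U V W. upwind_solution a \<alpha> \<mu> b \<gamma>r \<gamma>l uinit vinit \<tau> h N U V W) \<and>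
      (\<forall>U V W U' V' W'.
         upwind_solution a \<alpha> \<mu> b \<gamma>r \<gamma>l uinit vinit \<tau> h N U V W \<and>
         upwind_solution a \<alpha> \<mu> b \<gamma>r \<gamma>l uinit vinit \<tau> h N U' V' W' \<longrightarrow>
         (\<forall>n\<le>N. \<forall>j. U n j = U' n j \<and> W n j = W' n j \<and> (\<forall>k. V k n j = V' k n j))) \<and>
      (\<forall>U V W. upwind_solution a \<alpha> \<mu> b \<gamma>r \<gamma>l uinit vinit \<tau> h N U V W \<longrightarrow>
         TV_T \<tau> h N (\<lambda>n j. a (U n j)) (\<lambda>k n j. \<mu> k * b k (V k n j)) \<le> ennreal (C T))"
proof -
  have b_cont: "continuous_on UNIV (b k)" and b_mono: "mono (b k)" for k
    using b[of k] lipschitz_on_continuous_on unfolding play_output_def by blast+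
  obtain Ma where Ma: "\<And>(p :: nat \<Rightarrow> real) m. mono p \<Longrightarrow>
      (\<Sum>i<m. \<bar>a (uinit (p (Suc i))) - a (uinit (p i))\<bar>) \<le> Ma"
    using bv_a unfolding bounded_variation_def by blast
  obtain Mw where Mw: "\<And>k (p :: nat \<Rightarrow> real) m. mono p \<Longrightarrow>
      (\<Sum>i<m. \<bar>\<mu> k * b k (vinit k (p (Suc i))) - \<mu> k * b k (vinit k (p i))\<bar>) \<le> Mw k"
    using bv_w unfolding bounded_variation_def by metis
  define M where "M = Ma + (\<Sum>k\<in>UNIV. Mw k)"
  have M: "0 \<le> M"
    unfolding M_def using Ma[of "\<lambda>_. 0" 0] Mw[of "\<lambda>_. 0" _ 0] by (simp add: mono_def sum_nonneg)
  \<comment> \<open>A single admissible pair \<open>\<tau>, h\<close> bounds the flux slope; this bound serves for all others.\<close>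
  obtain L where L: "\<And>\<tau> h u. \<lbrakk>\<tau> > 0; h > 0; CFL \<alpha> \<tau> h\<rbrakk> \<Longrightarrow> deriv \<alpha> u \<le> L"
  proof (cases "\<exists>\<tau> h. \<tau> > 0 \<and> h > 0 \<and> CFL \<alpha> \<tau> h")
    case True
    then obtain \<tau> h where *: "\<tau> > 0" "h > 0" "CFL \<alpha> \<tau> h" by blast
    have "deriv \<alpha> u \<le> h / \<tau>" for u
      using * unfolding CFL_def by (auto simp: field_simps)
    then show ?thesis using that by blast
  \<comment> \<open>Without an admissible pair the requirement on \<open>L\<close> is
    vacuous.\<close>
  qed (use that in blast)
  show ?thesis
  \<comment> \<open>Since \<open>N \<ge> 1\<close>, the spatial part has total weight
    \<open>\<tau> * Suc N = T + \<tau> \<le> 2 * T\<close>; the temporal part has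
    \<open>\<tau> * N * L = T * L\<close>.\<close>
  proof (intro exI[of _ "\<lambda>T. T * (2 + L) * M"] allI impI)
    fix T \<tau> h :: real and N :: nat
    assume *: "T > 0 \<and> N \<ge> 1 \<and> \<tau> = T / real N \<and> h > 0 \<and> CFL \<alpha> \<tau> h"
    then have \<tau>: "\<tau> > 0" "real N * \<tau> = T" by auto
    interpret upwind_scheme a a0 \<alpha> uinit \<mu> b \<gamma>r \<gamma>l vinit \<tau> h N
      by (intro upwind_scheme.intro assms b_cont b_mono \<tau>) (use * in auto)
    have slope: "deriv \<alpha> u \<le> L" for u
      using L[OF \<tau>(1)] * by blast
    have le: "\<tau> * (real (Suc N) + real N * L) * M \<le> T * (2 + L) * M"
    proof (rule mult_right_mono[OF _ M])
      have "\<tau> * 1 \<le> \<tau> * real N" using * \<tau> by (intro mult_left_mono) auto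
      then show "\<tau> * (real (Suc N) + real N * L) \<le> T * (2 + L)"
        unfolding \<tau>(2)[symmetric] by (simp add: algebra_simps)
    qed
    have TV: "TV_T \<tau> h N (\<lambda>n j. a (U n j)) (\<lambda>k n j. \<mu> k * b k (V k n j))
        \<le> ennreal (T * (2 + L) * M)" if "is_solution U V W" for U V W
      by (rule order_trans[OF TV_T_le[OF that slope Ma Mw]]) (use le in \<open>simp_all add: M_def ennreal_leI\<close>)
    show "(\<exists>U V W. is_solution U V W) \<and>
      (\<forall>U V W U' V' W'. is_solution U V W \<and> is_solution U' V' W' \<longrightarrow>
         (\<forall>n\<le>N. \<forall>j. U n j = U' n j \<and> W n j = W' n j \<and> (\<forall>k. V k n j = V' k n j))) \<and>
      (\<forall>U V W. is_solution U V W \<longrightarrow>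
         TV_T \<tau> h N (\<lambda>n j. a (U n j)) (\<lambda>k n j. \<mu> k * b k (V k n j)) \<le> ennreal (T * (2 + L) * M))"
    proof (intro conjI[OF solution_exists conjI] allI impI)
      fix U V W U' V' W' n j
      assume "is_solution U V W \<and> is_solution U' V' W'" "n \<le> N"
      then show "U n j = U' n j \<and> W n j = W' n j \<and> (\<forall>k. V k n j = V' k n j)"
        by (elim conjE) (rule solution_unique)
    qed (rule TV)
  qed
qed

end
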